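(* Let $R=\mathbb{F}_2\langle a,x : a=a^2x\rangle$. Then every unit of $R$ is unipotent; that is, $R$ is a UU ring.
   Context: $R=\mathbb{F}_2\langle a,x: a=a^2x\rangle$ denotes the quotient of the free unital associative (noncommutative) $\mathbb{F}_2$-algebra on two generators $a,x$ by the two-sided ideal generated by $a-a^2x$. An element $u$ of a ring with identity is unipotent if $u-1$ is nilpotent; a ring with identity is UU if all its units are unipotent. *)

theory Defs
  imports
    "HOL-Library.Poly_Mapping"
    "HOL-Library.Z2"
    "HOL-Algebra.QuotRing"
    "HOL-Algebra.Algebraic_Closure_Type"
begin

definition nilpotent :: "('a, 'm) ring_scheme \<Rightarrow> 'a \<Rightarrow> bool" where
  "nilpotent R r \<longleftrightarrow> r \<in> carrier R \<and> (\<exists>n::nat. r [^]\<^bsub>R\<^esub> n = \<zero>\<^bsub>R\<^esub>)"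

definition unipotent :: "('a, 'm) ring_scheme \<Rightarrow> 'a \<Rightarrow> bool" where
  "unipotent R u \<longleftrightarrow> u \<in> carrier R \<and> nilpotent R (u \<ominus>\<^bsub>R\<^esub> \<one>\<^bsub>R\<^esub>)"

definition UU_ring :: "('a, 'm) ring_scheme \<Rightarrow> bool" where
  "UU_ring R \<longleftrightarrow> ring R \<and> (\<forall>u\<in>Units R. unipotent R u)"

text \<open>
  The free monoid on \<open>'g\<close>, written additively because the convolution product on
  \<open>'m \<Rightarrow>\<^sub>0 'k\<close> is based on the operation \<open>+\<close> of \<open>'m\<close>. Here \<open>+\<close> is concatenation and is
  not commutative.
\<close>

datatype 'g free_monoid = Word (letters: "'g list")

instantiation free_monoid :: (type) monoid_add
begin

definition zero_free_monoid :: "'a free_monoid" where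
  "0 = Word []"

definition plus_free_monoid :: "'a free_monoid \<Rightarrow> 'a free_monoid \<Rightarrow> 'a free_monoid" where
  "v + w = Word (letters v @ letters w)"

instance
  by standard (simp_all add: zero_free_monoid_def plus_free_monoid_def)

end

text \<open>
  The free unital associative algebra is the monoid algebra of the free monoid: finitely
  supported functions from words to scalars, with convolution as multiplication.
\<close>

type_synonym ('g, 'k) free_algebra = "'g free_monoid \<Rightarrow>\<^sub>0 'k"

definition free_var :: "'g \<Rightarrow> ('g, 'k::zero_neq_one) free_algebra" where
  "free_var g = Poly_Mapping.single (Word [g]) 1"

datatype gen = Gen_a | Gen_x

text \<open>The field with two elements is the type \<^typ>\<open>bit\<close>.\<close>

abbreviation F2_free :: "(gen, bit) free_algebra ring" where
  "F2_free \<equiv> ring_of_type_algebra"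

definition relator :: "(gen, bit) free_algebra" where
  "relator = free_var Gen_a - free_var Gen_a ^ 2 * free_var Gen_x"

definition R_alg :: "(gen, bit) free_algebra set ring" where
  "R_alg = F2_free Quot (Idl\<^bsub>F2_free\<^esub> {relator})"

lemma ring_F2_free: "ring F2_free"
proof (rule ringI)
  have "\<exists>y. y + x = 0" for x :: "(gen, bit) free_algebra"
    by (metis add.left_inverse)
  then show "abelian_group F2_free"
    by (intro abelian_groupI) (auto simp: ring_of_type_algebra_def algebra_simps)
  show "Group.monoid F2_free"
    by (rule monoidI) (auto simp: ring_of_type_algebra_def algebra_simps)
qed (auto simp: ring_of_type_algebra_def algebra_simps)

lemma ideal_relator: "ideal (Idl\<^bsub>F2_free\<^esub> {relator}) F2_free"
  by (rule ring.genideal_ideal[OF ring_F2_free])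
    (simp add: ring_of_type_algebra_def)

lemma ring_R_alg: "ring R_alg"
  unfolding R_alg_def by (rule ideal.quotient_is_ring[OF ideal_relator])

end

theory Submission
  imports Defs
begin

text \<open>
  Put \<open>y = a * x\<close> in \<open>R\<close>. Every occurrence of \<open>a\<close> that is followed by \<open>a * x\<close> can be absorbed, so the
  elements of \<open>R\<close> are sums \<open>p\<^sub>0 + p\<^sub>1 * a + \<dots> + p\<^sub>n * a ^ n\<close> with coefficients in the free algebra
  \<open>A\<close> on \<open>x\<close> and \<open>y\<close>, and the relations \<open>a * x = y\<close>, \<open>a * y = a\<close> say that \<open>R\<close> is a skew polynomial
  ring: \<open>a * f = D f + aug f * a\<close>, where \<open>aug\<close> is the character \<open>x \<mapsto> 0\<close>, \<open>y \<mapsto> 1\<close> and \<open>D\<close> is a skew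
  derivation with \<open>D x = y\<close> and \<open>D y = 0\<close>. Hence \<open>R\<close> acts on \<open>A = R / R a\<close>, with \<open>A\<close> acting by left
  multiplication and \<open>a\<close> by \<open>D\<close>. This action is faithful (\<open>act_faithful\<close>), so identities in \<open>R\<close> can be
  checked on elements of \<open>A\<close>.

  The heart of the proof is \<open>ore_regular\<close>: if \<open>p\<^sub>0 + p\<^sub>1 * a + \<dots>\<close> kills a nonzero element of \<open>A\<close>, then
  \<open>p\<^sub>0 = 0\<close>. Let \<open>u\<close> be a unit with inverse \<open>v\<close>. The element \<open>a * u\<close> kills \<open>v \<bullet> 1 \<noteq> 0\<close>, because \<open>a\<close>
  kills \<open>1\<close>; therefore its coefficient at \<open>a ^ 0\<close>, which is \<open>D (u \<bullet> 1)\<close>, vanishes. Then \<open>v\<close> acts on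
  \<open>u \<bullet> 1\<close> through its coefficient at \<open>a ^ 0\<close> alone, so \<open>u \<bullet> 1\<close> has a left inverse in the free
  algebra \<open>A\<close> and must be \<open>1\<close>. Thus every unit fixes \<open>1\<close> and has the form \<open>1 + r * a\<close>.

  Consequently \<open>a * u = u' * a\<close> with \<open>u' = 1 + a * r\<close>, which is again a unit, and this can be
  iterated: \<open>a ^ k * u = u\<^sub>k * a ^ k\<close> with \<open>u\<^sub>k\<close> in \<open>1 + R * a\<close>. It follows that \<open>(u - 1) ^ k\<close> lies in
  \<open>R * a ^ k\<close>, say \<open>(u - 1) ^ k = s * a ^ k\<close>, and \<open>(u - 1) ^ (n + 1) = s * a ^ n * (u - 1)\<close> is zero as soon
  as \<open>a ^ n * u = a ^ n\<close>.

  Such an \<open>n\<close> exists (\<open>unit_stable\<close>): for large \<open>n\<close>, left multiplication by \<open>a ^ n\<close> turns every element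
  of \<open>R\<close> into a polynomial in \<open>a\<close> alone. So \<open>a ^ n * u = f(a)\<close> and \<open>a ^ m * v = h(a)\<close>, where
  \<open>f * h\<close> is the monomial of degree \<open>n + m\<close>. Thus \<open>f(a)\<close> and \<open>h(a)\<close> are powers of \<open>a\<close>, and
  the exponents are \<open>n\<close> and \<open>m\<close>, since \<open>a ^ n * u = u\<^sub>n * a ^ n\<close> kills whatever \<open>a ^ n\<close> kills.
\<close>

section \<open>Free algebras over the field with two elements\<close>

type_synonym 'g falg = "('g, bit) free_algebra"

definition wmon :: "'g list \<Rightarrow> 'g falg" where
  "wmon w = Poly_Mapping.single (Word w) 1"

lemma wmon_Nil: "wmon [] = 1"
  by (simp add: wmon_def flip: zero_free_monoid_def)

lemma wmon_append: "wmon (v @ w) = wmon v * wmon w"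
  by (simp add: wmon_def mult_single plus_free_monoid_def)

lemma wmon_Cons: "wmon (g # w) = wmon [g] * wmon w"
  by (simp flip: wmon_append)

lemma falg_double [simp]: "(f :: 'g falg) + f = 0"
  by (rule poly_mapping_eqI) (simp add: lookup_add)

lemma falg_uminus [simp]: "- (f :: 'g falg) = f"
  by (rule minus_unique) simp

lemma falg_diff [simp]: "(f :: 'g falg) - h = f + h"
  by (metis diff_conv_add_uminus falg_uminus)

lemma falg_add_eq_0_iff: "(f :: 'g falg) + h = 0 \<longleftrightarrow> f = h"
  using add_eq_0_iff[of f h] by auto

lemma falg_double_left [simp]: "(f :: 'g falg) + (f + h) = h"
  by (metis add.assoc add_0 falg_double)

lemma falg_mon_sum: "(\<Sum>w\<in>Poly_Mapping.keys f. wmon (letters w)) = (f :: 'g falg)"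
proof (rule poly_mapping_eqI)
  fix k :: "'g free_monoid"
  have "Poly_Mapping.lookup (wmon (letters w)) k = (if w = k then 1 else 0)" for w
    by (cases w) (simp add: wmon_def lookup_single when_def)
  then show "Poly_Mapping.lookup (\<Sum>w\<in>Poly_Mapping.keys f. wmon (letters w)) k = Poly_Mapping.lookup f k"
    by (auto simp: lookup_sum sum.delta' in_keys_iff)
qed

lemma falg_induct [case_names zero add]:
  assumes "P 0" and "\<And>w f. P f \<Longrightarrow> P (wmon w + f)"
  shows "P (f :: 'g falg)"
proof -
  have "P (\<Sum>w\<in>W. wmon (letters w))" if "finite W" for W :: "'g free_monoid set"
    using that by induction (auto intro: assms)
  from this[of "Poly_Mapping.keys f"] show ?thesis
    by (simp add: falg_mon_sum)
qed

text \<open>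
  Linear extension of a map on words. Over the field with two elements an element of the free algebra is
  the set of its words, so no scalars occur.
\<close>
definition lin :: "('g list \<Rightarrow> 'h falg) \<Rightarrow> 'g falg \<Rightarrow> 'h falg" where
  "lin \<phi> f = (\<Sum>w\<in>Poly_Mapping.keys f. \<phi> (letters w))"

lemma lin_superset:
  assumes "finite W" "Poly_Mapping.keys f \<subseteq> W"
  shows "lin \<phi> f = (\<Sum>w\<in>W. if Poly_Mapping.lookup f w = 1 then \<phi> (letters w) else 0)"
  unfolding lin_def using assms
  by (intro sum.mono_neutral_cong_left) (auto simp: in_keys_iff)

lemma lin_zero [simp]: "lin \<phi> 0 = 0"
  by (simp add: lin_def)

lemma lin_mon [simp]: "lin \<phi> (wmon w) = \<phi> w"
  by (simp add: lin_def wmon_def)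

lemma lin_one [simp]: "lin \<phi> 1 = \<phi> []"
  using lin_mon[of \<phi> "[]"] by (simp add: wmon_Nil)

lemma lin_add [simp]:
  fixes \<phi> :: "'g list \<Rightarrow> 'h falg"
  shows "lin \<phi> (f + h) = lin \<phi> f + lin \<phi> h"
proof -
  let ?W = "Poly_Mapping.keys f \<union> Poly_Mapping.keys h"
  have "(if Poly_Mapping.lookup (f + h) w = 1 then z else 0) =
      (if Poly_Mapping.lookup f w = 1 then z else 0) + (if Poly_Mapping.lookup h w = 1 then z else 0)"
    for w and z :: "'h falg"
    by (cases "Poly_Mapping.lookup f w"; cases "Poly_Mapping.lookup h w") (simp_all add: lookup_add)
  note bitwise = this
  show ?thesis
    using keys_add[of f h] by (simp add: lin_superset[of ?W] bitwise sum.distrib)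
qed

lemma lin_mult_left: "lin \<phi> (wmon v * f) = lin (\<lambda>w. \<phi> (v @ w)) f"
  by (induction f rule: falg_induct) (simp_all add: distrib_left flip: wmon_append)

lemma lin_mult_right: "lin \<phi> (f * wmon v) = lin (\<lambda>w. \<phi> (w @ v)) f"
  by (induction f rule: falg_induct) (simp_all add: distrib_right flip: wmon_append)

lemma lin_id: "lin wmon f = f"
  by (simp add: lin_def falg_mon_sum)

lemma lin_const_zero [simp]: "lin (\<lambda>w. 0) f = 0"
  by (simp add: lin_def)

text \<open>
  A strict bound on word lengths, used in place of a degree function: the bound \<open>0\<close> singles out the zero
  element, which serves as the base of inductions.
\<close>
definition shorter :: "nat \<Rightarrow> 'g falg \<Rightarrow> bool" where
  "shorter n f \<longleftrightarrow> (\<forall>w\<in>Poly_Mapping.keys f. length (letters w) < n)"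

lemma shorter_zero_iff: "shorter 0 f \<longleftrightarrow> f = 0"
  by (auto simp: shorter_def)

lemma shorter_0 [simp]: "shorter n 0"
  by (simp add: shorter_def)

lemma shorter_mon [simp]: "shorter n (wmon w) \<longleftrightarrow> length w < n"
  by (simp add: shorter_def wmon_def)

lemma shorter_add: "shorter n f \<Longrightarrow> shorter n h \<Longrightarrow> shorter n (f + h)"
  unfolding shorter_def using keys_add[of f h] by blast

lemma shorter_sum: "(\<And>i. i \<in> I \<Longrightarrow> shorter n (F i)) \<Longrightarrow> shorter n (sum F I)"
  by (induction I rule: infinite_finite_induct) (auto intro: shorter_add)

lemma shorter_lin:
  assumes "\<And>w. length w < n \<Longrightarrow> shorter m (\<phi> w)" "shorter n f"
  shows "shorter m (lin \<phi> f)"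
  unfolding lin_def
proof (rule shorter_sum)
  fix w assume "w \<in> Poly_Mapping.keys f"
  with assms show "shorter m (\<phi> (letters w))"
    unfolding shorter_def[of n] by blast
qed

lemma shorter_exists: "\<exists>n. shorter n f"
proof
  show "shorter (Suc (Max ((\<lambda>w. length (letters w)) ` Poly_Mapping.keys f))) f"
    by (auto simp: shorter_def less_Suc_eq_le)
qed

lemma longest_word:
  assumes "f \<noteq> 0"
  obtains w where "w \<in> Poly_Mapping.keys f"
    "\<And>w'. w' \<in> Poly_Mapping.keys f \<Longrightarrow> length (letters w') \<le> length (letters w)"
proof -
  let ?L = "(\<lambda>w. length (letters w)) ` Poly_Mapping.keys f"
  have "Max ?L \<in> ?L"
    using assms by (intro Max_in) auto
  then obtain w where "w \<in> Poly_Mapping.keys f" "length (letters w) = Max ?L"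
    by (metis (mono_tags) imageE)
  then show ?thesis
    using that by simp
qed

text \<open>
  The free algebra has no units but \<open>1\<close>: a product of words of maximal length in the two factors arises in
  only one way, so it cannot cancel, and it is the empty word only if all the words are empty.
\<close>
lemma falg_left_inverse_trivial:
  assumes "h * f = (1 :: 'g falg)"
  shows "f = 1"
proof -
  let ?len = "\<lambda>w. length (letters w)"
  have ne: "Poly_Mapping.keys f \<noteq> {}" "Poly_Mapping.keys h \<noteq> {}" using assms by auto
  obtain w where w: "w \<in> Poly_Mapping.keys f" "\<And>w'. w' \<in> Poly_Mapping.keys f \<Longrightarrow> ?len w' \<le> ?len w"
    using longest_word[of f] ne(1) by auto
  obtain v where v: "v \<in> Poly_Mapping.keys h" "\<And>v'. v' \<in> Poly_Mapping.keys h \<Longrightarrow> ?len v' \<le> ?len v"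
    using longest_word[of h] ne(2) by auto
  define \<phi> :: "'g list \<Rightarrow> 'g falg" where "\<phi> u = (if u = letters v @ letters w then 1 else 0)" for u
  have lin_sum: "lin \<phi> (sum F I) = (\<Sum>i\<in>I. lin \<phi> (F i))" for F and I :: "'x set"
    by (induction I rule: infinite_finite_induct) auto
  have top: "\<phi> (letters v' @ letters w') = (if w = w' then if v = v' then 1 else 0 else 0)"
    if "v' \<in> Poly_Mapping.keys h" "w' \<in> Poly_Mapping.keys f" for v' w'
  proof -
    have "letters v' @ letters w' = letters v @ letters w \<longleftrightarrow> letters v' = letters v \<and> letters w' = letters w"
      if "length (letters v') \<le> length (letters v)" "length (letters w') \<le> length (letters w)"
      using that by (metis add_mono_thms_linordered_field(3) append_eq_append_conv
          length_append less_irrefl nat_less_le)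
    then show ?thesis using v(2)[OF that(1)] w(2)[OF that(2)] by (auto simp: \<phi>_def free_monoid.expand)
  qed
  have "h * f = (\<Sum>v'\<in>Poly_Mapping.keys h. \<Sum>w'\<in>Poly_Mapping.keys f. wmon (letters v' @ letters w'))"
    by (simp add: wmon_append falg_mon_sum flip: sum_distrib_left sum_distrib_right)
  then have "lin \<phi> (h * f) = (\<Sum>v'\<in>Poly_Mapping.keys h. \<Sum>w'\<in>Poly_Mapping.keys f. \<phi> (letters v' @ letters w'))"
    by (simp add: lin_sum)
  also have "\<dots> = 1"
    using v(1) w(1) by (simp add: top cong: sum.cong)
  finally have "\<phi> [] = 1"
    using assms by simp
  then have "letters w = []" by (auto simp: \<phi>_def split: if_splits)
  then have "Poly_Mapping.keys f \<subseteq> {0}"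
    using w(2) by (auto simp: zero_free_monoid_def intro: free_monoid.expand)
  then have "Poly_Mapping.keys f = {0}" using ne by (metis subset_singletonD)
  then show ?thesis
    using falg_mon_sum[of f] by (simp add: wmon_Nil zero_free_monoid_def)
qed

section \<open>The skew derivation on the free algebra in two letters\<close>

datatype letter = Lx | Ly

abbreviation vx :: "letter falg" where "vx \<equiv> wmon [Lx]"
abbreviation vy :: "letter falg" where "vy \<equiv> wmon [Ly]"

fun D_word :: "letter list \<Rightarrow> letter falg" where
  "D_word [] = 0"
| "D_word (Lx # w) = wmon (Ly # w)"
| "D_word (Ly # w) = D_word w"

text \<open>
  The action of \<open>a\<close> on the free algebra. On words it is the computation of \<open>a * w\<close> by \<open>a * x = y\<close> and
  \<open>a * y = a\<close>, modulo the left multiples of \<open>a\<close>.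
\<close>
definition D :: "letter falg \<Rightarrow> letter falg" where
  "D = lin D_word"

fun aug_word :: "letter list \<Rightarrow> letter falg" where
  "aug_word [] = 1"
| "aug_word (Lx # w) = 0"
| "aug_word (Ly # w) = aug_word w"

text \<open>
  The character with \<open>x \<mapsto> 0\<close>, \<open>y \<mapsto> 1\<close>. Its values are the scalars \<open>0\<close> and \<open>1\<close>, taken in the algebra itself
  so that they can be multiplied with its elements.
\<close>
definition aug :: "letter falg \<Rightarrow> letter falg" where
  "aug = lin aug_word"

definition const_part :: "'g falg \<Rightarrow> 'g falg" where
  "const_part = lin (\<lambda>w. if w = [] then 1 else 0)"

definition strip :: "'g \<Rightarrow> 'g falg \<Rightarrow> 'g falg" where
  "strip l = lin (\<lambda>w. if w \<noteq> [] \<and> last w = l then wmon (butlast w) else 0)"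

lemma D_simps [simp]:
  "D 0 = 0" "D 1 = 0" "D (f + h) = D f + D h" "D (vx * f) = vy * f" "D (vy * f) = D f"
  by (simp_all add: D_def lin_mult_left wmon_Cons[of _ "_ # _"] flip: wmon_append)
    (simp add: lin_id flip: lin_mult_left[of wmon "[Ly]", simplified])

lemma D_letters [simp]: "D vx = vy" "D vy = 0"
  using D_simps(4)[of 1] D_simps(5)[of 1] by simp_all

lemma D_funpow_simps [simp]:
  "(D ^^ n) 0 = 0" "(D ^^ n) (f + h) = (D ^^ n) f + (D ^^ n) h"
  by (induction n) simp_all

lemma aug_simps [simp]:
  "aug 0 = 0" "aug 1 = 1" "aug (f + h) = aug f + aug h" "aug (vx * f) = 0" "aug (vy * f) = aug f"
  by (simp_all add: aug_def lin_mult_left)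

lemma D_mult: "D (f * g) = D f * g + aug f * D g"
proof -
  have word: "D (wmon w * g) = D (wmon w) * g + aug (wmon w) * D g" for w
  proof (induction w)
    case Nil
    then show ?case by (simp add: wmon_Nil)
  next
    case (Cons l w)
    then show ?case
      by (cases l) (simp_all add: wmon_Cons[of _ w] mult.assoc)
  qed
  show ?thesis
    by (induction f rule: falg_induct) (simp_all add: word distrib_right algebra_simps)
qed

lemma const_part_simps [simp]:
  "const_part 0 = 0" "const_part 1 = 1" "const_part (f + h) = const_part f + const_part h"
  "const_part (wmon (l # w)) = 0"
  by (simp_all add: const_part_def)

lemma const_part_cases: "const_part f = 0 \<or> const_part f = 1"
  by (induction f rule: falg_induct) (auto simp: const_part_def)

lemma const_part_mult [simp]: "const_part (f * h) = const_part f * const_part h"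
proof -
  have word: "const_part (wmon w * h) = const_part (wmon w) * const_part h" for w
    by (cases w) (simp_all add: wmon_Nil const_part_def lin_mult_left)
  show ?thesis
    by (induction f rule: falg_induct) (simp_all add: word distrib_right)
qed

lemma const_part_D [simp]: "const_part (D f) = 0"
proof -
  have "const_part (D_word w) = 0" for w
    by (induction w rule: D_word.induct) simp_all
  then show ?thesis
    by (induction f rule: falg_induct) (simp_all add: D_def)
qed

lemma strip_simps [simp]:
  "strip l 0 = 0" "strip l 1 = 0" "strip l (f + h) = strip l f + strip l h"
  "strip l (f * wmon [l']) = (if l = l' then f else 0)"
  by (simp_all add: strip_def lin_mult_right lin_id)

lemma shorter_strip: "shorter (Suc n) f \<Longrightarrow> shorter n (strip l f)"
  unfolding strip_def
proof (rule shorter_lin)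
  show "shorter n (if w \<noteq> [] \<and> last w = l then wmon (butlast w) else 0)" if "length w < Suc n" for w
    using that by (cases w rule: rev_exhaust) auto
qed

lemma right_decomp: "f = const_part f + strip Lx f * vx + strip Ly f * vy"
proof (induction f rule: falg_induct)
  case (add w f)
  have "wmon w = const_part (wmon w) + strip Lx (wmon w) * vx + strip Ly (wmon w) * vy"
    by (cases w rule: rev_exhaust; cases "last w")
      (simp_all add: const_part_def strip_def wmon_Nil wmon_append lin_mult_right)
  from arg_cong2[where f = "(+)", OF this add]
  have "wmon w + f = (const_part (wmon w) + strip Lx (wmon w) * vx + strip Ly (wmon w) * vy) +
      (const_part f + strip Lx f * vx + strip Ly f * vy)" .
  also have "\<dots> = const_part (wmon w + f) + strip Lx (wmon w + f) * vx + strip Ly (wmon w + f) * vy"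
    by (simp add: algebra_simps)
  finally show ?case .
qed simp

lemma right_decomp_eq_0_iff: "f * vx + h * vy = 0 \<longleftrightarrow> f = 0 \<and> h = 0"
  by (metis strip_simps(1,3,4) add_0 add.right_neutral letter.distinct(1) mult_zero_left)

lemma vy_mult_eq_0_iff [simp]: "vy * f = 0 \<longleftrightarrow> f = 0"
proof
  assume "vy * f = 0"
  moreover have "lin (\<lambda>w. wmon (tl w)) (vy * f) = f"
    by (simp add: lin_mult_left lin_id)
  ultimately show "f = 0" by simp
qed simp

text \<open>
  A list \<open>[p\<^sub>0, p\<^sub>1, \<dots>]\<close> stands for the skew polynomial \<open>p\<^sub>0 + p\<^sub>1 * a + \<dots>\<close>, here as an operator in which
  \<open>a\<close> becomes \<open>D\<close>.
\<close>
fun ore :: "letter falg list \<Rightarrow> letter falg \<Rightarrow> letter falg" where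
  "ore [] g = 0"
| "ore (p # ps) g = p * g + ore ps (D g)"

lemma ore_zero [simp]: "ore ps 0 = 0"
  by (induction ps) simp_all

lemma ore_add: "ore ps (f + h) = ore ps f + ore ps h"
  by (induction ps arbitrary: f h) (simp_all add: algebra_simps)

lemma ore_mult_vy: "ore ps (f * vy) = ore ps f * vy"
  by (induction ps arbitrary: f) (simp_all add: D_mult algebra_simps)

text \<open>
  Skew polynomials almost commute with right multiplication by letters: the error term in
  \<open>D (f * vx) = D f * vx + aug f * vy\<close> ends in \<open>y\<close>, so the part ending in \<open>x\<close> is transformed as expected.
\<close>
lemma ore_mult_vx: "\<exists>s. ore ps (f * vx) = ore ps f * vx + s * vy"
proof (induction ps arbitrary: f)
  case Nil
  show ?case by (auto intro: exI[of _ 0])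
next
  case (Cons p ps)
  obtain s where "ore ps (D f * vx) = ore ps (D f) * vx + s * vy"
    using Cons by blast
  then have "ore (p # ps) (f * vx) = ore (p # ps) f * vx + (s + ore ps (aug f)) * vy"
    by (simp add: D_mult ore_add ore_mult_vy algebra_simps)
  then show ?case by blast
qed

lemma ore_const_part_D: "const_part (ore ps (D g)) = 0"
  by (induction ps arbitrary: g) simp_all

lemma ore_right_decomp_eq_0:
  assumes "ore ps (f * vx + h * vy) = 0"
  shows "ore ps f = 0" and "f = 0 \<Longrightarrow> ore ps h = 0"
proof -
  obtain s where "ore ps (f * vx) = ore ps f * vx + s * vy"
    using ore_mult_vx by blast
  with assms have *: "ore ps f * vx + (s + ore ps h) * vy = 0"
    by (simp add: ore_add ore_mult_vy algebra_simps)
  then show "ore ps f = 0"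
    by (simp add: right_decomp_eq_0_iff)
  show "ore ps h = 0" if "f = 0"
    using that assms right_decomp_eq_0_iff[of 0 "ore ps h"] by (simp add: ore_mult_vy)
qed

text \<open>
  The induction is on the length of \<open>g\<close>, and then on the length of \<open>p\<close>.
  Write \<open>g = c + f * vx + h * vy\<close> with a constant \<open>c\<close>. If \<open>c = 0\<close>, the skew polynomial kills \<open>f\<close>, and it kills
  \<open>h\<close> if \<open>f = 0\<close>; one of these is nonzero and shorter than \<open>g\<close>.

  If \<open>c = 1\<close>, comparing constants gives \<open>p = \<alpha> * vx + \<beta> * vy\<close>. Now \<open>p + p\<^sub>1 * a + \<dots>\<close> equals
  \<open>(\<alpha> + \<beta> * a + p\<^sub>1 * a\<^sup>2 + \<dots>) * x\<close>, and the skew polynomial in parentheses kills \<open>vx * g\<close>. The part of \<open>vx * g\<close> that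
  ends in \<open>x\<close> is \<open>(vx * f + 1) * vx\<close>, where \<open>vx * f + 1\<close> is no longer than \<open>g\<close> and nonzero, while \<open>\<alpha>\<close> is
  shorter than \<open>p\<close>; so the inner induction hypothesis yields \<open>\<alpha> = 0\<close>. Two similar steps yield \<open>\<beta> = 0\<close>.
\<close>
lemma ore_regular:
  assumes "ore (p # ps) g = 0" "g \<noteq> 0"
  shows "p = 0"
proof -
  have "p = 0" if "shorter n g" "shorter m p" "ore (p # ps) g = 0" "g \<noteq> 0" for n m p ps g
    using that
  proof (induction n arbitrary: m p ps g)
    case 0
    then show ?case by (simp add: shorter_zero_iff)
  next
    case (Suc n)
    note short = Suc.IH
    show ?case
      using Suc.prems
    proof (induction m arbitrary: p ps g)
      case 0
      then show ?case by (simp add: shorter_zero_iff)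
    next
      case (Suc m)
      note IH = Suc.IH
      define f h where "f = strip Lx g" and "h = strip Ly g"
      have g: "g = const_part g + f * vx + h * vy"
        unfolding f_def h_def by (rule right_decomp)
      have fh: "shorter n f" "shorter n h"
        using Suc.prems(1) by (simp_all add: f_def h_def shorter_strip)
      have vy_left: "shorter (Suc n) (wmon [l] * k)" if "shorter n k" for l and k :: "letter falg"
      proof -
        have "shorter (Suc n) (lin (\<lambda>w. wmon (l # w)) k)"
          by (rule shorter_lin[OF _ that]) simp
        then show ?thesis
          using lin_mult_left[of wmon "[l]" k] by (simp add: lin_id)
      qed
      from const_part_cases[of g] show ?case
      proof
        assume "const_part g = 0"
        then have g: "g = f * vx + h * vy" using g by simp
        show ?thesis
        proof (cases "f = 0")
          case True
          then have "h \<noteq> 0" using g Suc.prems(4) by auto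
          moreover have "ore (p # ps) h = 0"
            using ore_right_decomp_eq_0(2)[of "p # ps"] Suc.prems(3) g True by metis
          ultimately show ?thesis
            using short fh(2) Suc.prems(2) by blast
        next
          case False
          moreover have "ore (p # ps) f = 0"
            using ore_right_decomp_eq_0(1)[of "p # ps"] Suc.prems(3) g by metis
          ultimately show ?thesis
            using short fh(1) Suc.prems(2) by blast
        qed
      next
        assume one: "const_part g = 1"
        then have g: "g = 1 + f * vx + h * vy" using g by simp
        have "const_part p = const_part (ore (p # ps) g)"
          by (simp add: ore_const_part_D one)
        then have "const_part p = 0"
          using Suc.prems(3) by (metis const_part_simps(1))
        define \<alpha> \<beta> where "\<alpha> = strip Lx p" and "\<beta> = strip Ly p"
        have p: "p = \<alpha> * vx + \<beta> * vy"
          using right_decomp[of p] \<open>const_part p = 0\<close> by (simp add: \<alpha>_def \<beta>_def)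
        have \<alpha>\<beta>: "shorter m \<alpha>" "shorter m \<beta>"
          using Suc.prems(2) by (simp_all add: \<alpha>_def \<beta>_def shorter_strip)
        \<comment> \<open>The identity \<open>a * x = y\<close>, and \<open>a ^ (i + 1) * x = a ^ i\<close> for \<open>i \<ge> 1\<close>.\<close>
        have "ore (\<alpha> # \<beta> # ps) (vx * g) = ore (p # ps) g"
          by (simp add: p algebra_simps)
        also have "vx * g = (vx * f + 1) * vx + (vx * h) * vy"
          by (simp add: g algebra_simps)
        finally have xg: "ore (\<alpha> # \<beta> # ps) ((vx * f + 1) * vx + (vx * h) * vy) = 0"
          using Suc.prems(3) by simp
        have *: "ore (\<alpha> # \<beta> # ps) (vx * f + 1) = 0"
          using ore_right_decomp_eq_0(1)[OF xg] .
        have short1: "shorter (Suc n) (1 :: letter falg)"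
          by (simp flip: wmon_Nil)
        have ne: "vx * k + 1 \<noteq> 0" "1 + vy * k \<noteq> 0" for k
          by (metis const_part_simps(1-4) const_part_mult add_0 add.right_neutral mult_zero_left zero_neq_one)+
        have "\<alpha> = 0"
          by (intro IH[OF _ \<alpha>\<beta>(1) *]) (simp_all add: ne shorter_add short1 vy_left fh)
        show ?thesis
        proof (cases "f = 0")
          case False
          have "ore (\<beta> # ps) (vy * f) = 0"
            using * \<open>\<alpha> = 0\<close> by simp
          from IH[OF _ \<alpha>\<beta>(2) this] have "\<beta> = 0"
            by (simp add: False vy_left fh)
          then show ?thesis using p \<open>\<alpha> = 0\<close> by simp
        next
          case True
          have "ore (p # ps) g = \<beta> * vy + (\<beta> * vy * h + ore ps (D h)) * vy"
            using p \<open>\<alpha> = 0\<close> True by (simp add: g D_mult ore_mult_vy algebra_simps)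
          then have "(ore (\<beta> # ps) (1 + vy * h)) * vy = 0"
            using Suc.prems(3) by (simp add: algebra_simps)
          then have "ore (\<beta> # ps) (1 + vy * h) = 0"
            using right_decomp_eq_0_iff[of 0] by simp
          from IH[OF _ \<alpha>\<beta>(2) this] have "\<beta> = 0"
            by (simp add: ne shorter_add short1 vy_left fh)
          then show ?thesis using p \<open>\<alpha> = 0\<close> by simp
        qed
      qed
    qed
  qed
  with assms shorter_exists[of g] shorter_exists[of p] show ?thesis
    by blast
qed

section \<open>The action of R and normal forms\<close>

abbreviation ga :: "gen falg" where "ga \<equiv> wmon [Gen_a]"
abbreviation gx :: "gen falg" where "gx \<equiv> wmon [Gen_x]"

fun act_word :: "gen list \<Rightarrow> letter falg \<Rightarrow> letter falg" where
  "act_word [] g = g"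
| "act_word (Gen_a # w) g = D (act_word w g)"
| "act_word (Gen_x # w) g = vx * act_word w g"

text \<open>
  The action of the free algebra on generators \<open>a\<close>, \<open>x\<close>. It respects the relation \<open>a = a\<^sup>2 * x\<close>
  because \<open>D (D (vx * g)) = D (vy * g) = D g\<close>.
\<close>
definition act :: "gen falg \<Rightarrow> letter falg \<Rightarrow> letter falg" (infixr "\<bullet>" 71) where
  "r \<bullet> g = lin (\<lambda>w. act_word w g) r"

lemma act_word_add [simp]: "act_word w (f + h) = act_word w f + act_word w h"
  by (induction w f rule: act_word.induct) (simp_all add: distrib_left)

lemma act_word_zero [simp]: "act_word w 0 = 0"
  using act_word_add[of w 0 0] by simp

lemma act_simps [simp]:
  "0 \<bullet> g = 0" "1 \<bullet> g = g" "(r + s) \<bullet> g = r \<bullet> g + s \<bullet> g" "ga \<bullet> g = D g" "gx \<bullet> g = vx * g"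
  by (simp_all add: act_def)

lemma act_right_simps [simp]: "r \<bullet> 0 = 0" "r \<bullet> (f + h) = r \<bullet> f + r \<bullet> h"
  by (simp_all add: act_def lin_def sum.distrib)

lemma act_mult [simp]: "(r * s) \<bullet> g = r \<bullet> s \<bullet> g"
proof -
  have append: "act_word (v @ w) g = act_word v (act_word w g)" for v w
    by (induction v g rule: act_word.induct) simp_all
  have "(wmon v * s) \<bullet> g = wmon v \<bullet> s \<bullet> g" for v
    by (induction s rule: falg_induct) (simp_all add: distrib_left act_def append flip: wmon_append)
  then show ?thesis
    by (induction r rule: falg_induct) (simp_all add: distrib_right)
qed

fun emb_word :: "letter list \<Rightarrow> gen falg" where
  "emb_word [] = 1"
| "emb_word (Lx # w) = gx * emb_word w"
| "emb_word (Ly # w) = ga * gx * emb_word w"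

text \<open>
  The lift of \<open>A\<close> to the free algebra on \<open>a\<close>, \<open>x\<close>, with \<open>y \<mapsto> a * x\<close>.
\<close>
definition emb :: "letter falg \<Rightarrow> gen falg" where
  "emb = lin emb_word"

fun emb_ore :: "letter falg list \<Rightarrow> gen falg" where
  "emb_ore [] = 0"
| "emb_ore (p # ps) = emb p + emb_ore ps * ga"

lemma emb_simps [simp]:
  "emb 0 = 0" "emb 1 = 1" "emb (f + h) = emb f + emb h"
  by (simp_all add: emb_def)

lemma emb_vx_mult: "emb (vx * f) = gx * emb f"
  by (induction f rule: falg_induct) (simp_all add: emb_def distrib_left flip: wmon_append)

lemma emb_act [simp]: "emb f \<bullet> g = f * g"
proof -
  have "emb_word w \<bullet> g = wmon w * g" for w
  proof (induction w rule: emb_word.induct)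
    case (2 w)
    then show ?case by (simp add: wmon_Cons[of _ w] mult.assoc)
  next
    case (3 w)
    then show ?case by (simp add: wmon_Cons[of _ w] mult.assoc)
  qed (simp add: wmon_Nil)
  then show ?thesis
    by (induction f rule: falg_induct) (simp_all add: emb_def distrib_right)
qed

lemma emb_ore_act [simp]: "emb_ore ps \<bullet> g = ore ps g"
  by (induction ps arbitrary: g) simp_all

definition rel_ideal :: "gen falg set" where
  "rel_ideal = Idl\<^bsub>F2_free\<^esub> {relator}"

lemma F2_free_simps [simp]:
  "carrier F2_free = UNIV" "\<zero>\<^bsub>F2_free\<^esub> = 0" "\<one>\<^bsub>F2_free\<^esub> = 1"
  "f \<oplus>\<^bsub>F2_free\<^esub> h = f + h" "f \<otimes>\<^bsub>F2_free\<^esub> h = f * h"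
  by (simp_all add: ring_of_type_algebra_def)

lemma ideal_rel_ideal: "ideal rel_ideal F2_free"
  unfolding rel_ideal_def by (rule ideal_relator)

lemma rel_ideal_zero: "0 \<in> rel_ideal"
  using additive_subgroup.zero_closed[OF ideal.axioms(1)[OF ideal_rel_ideal]] by simp

lemma rel_ideal_add: "f \<in> rel_ideal \<Longrightarrow> h \<in> rel_ideal \<Longrightarrow> f + h \<in> rel_ideal"
  using additive_subgroup.a_closed[OF ideal.axioms(1)[OF ideal_rel_ideal]] by simp

lemma rel_ideal_mult:
  "f \<in> rel_ideal \<Longrightarrow> h * f \<in> rel_ideal" "f \<in> rel_ideal \<Longrightarrow> f * h \<in> rel_ideal"
  using ideal.I_l_closed[OF ideal_rel_ideal] ideal.I_r_closed[OF ideal_rel_ideal] by simp_all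

lemma relator_eq: "relator = ga + ga * ga * gx"
  by (simp add: relator_def free_var_def wmon_def power2_eq_square)

lemma relator_in_rel_ideal: "ga + ga * ga * gx \<in> rel_ideal"
  unfolding rel_ideal_def relator_eq[symmetric]
  by (rule ring.genideal_self'[OF ring_F2_free]) simp

text \<open>
  The annihilator of the module is a two-sided ideal that contains the relator.
\<close>
lemma rel_ideal_act: "r \<in> rel_ideal \<Longrightarrow> r \<bullet> g = 0"
proof -
  let ?J = "{r. \<forall>g. r \<bullet> g = 0}"
  interpret ring F2_free by (rule ring_F2_free)
  have minus: "\<ominus>\<^bsub>F2_free\<^esub> r = r" for r
    by (rule minus_equality) simp_all
  have "ideal ?J F2_free"
  proof (rule idealI[OF ring_F2_free])
    show "subgroup ?J (add_monoid F2_free)"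
      by (rule add.subgroupI) (auto simp: minus intro: exI[of _ 0])
  qed auto
  moreover have "relator \<in> ?J"
    by (simp add: relator_eq)
  ultimately have "rel_ideal \<subseteq> ?J"
    unfolding rel_ideal_def by (intro ring.genideal_minimal[OF ring_F2_free]) simp_all
  then show "r \<in> rel_ideal \<Longrightarrow> r \<bullet> g = 0" by blast
qed

definition cong_rel :: "gen falg \<Rightarrow> gen falg \<Rightarrow> bool" (infix "\<asymp>" 50) where
  "r \<asymp> s \<longleftrightarrow> r + s \<in> rel_ideal"

lemma cong_refl [simp]: "r \<asymp> r"
  by (simp add: cong_rel_def rel_ideal_zero)

lemma cong_trans [trans]: "r \<asymp> s \<Longrightarrow> s \<asymp> t \<Longrightarrow> r \<asymp> t"
  unfolding cong_rel_def using rel_ideal_add[of "r + s" "s + t"] by (simp add: add.assoc)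

lemma cong_add: "r \<asymp> s \<Longrightarrow> r' \<asymp> s' \<Longrightarrow> r + r' \<asymp> s + s'"
  unfolding cong_rel_def using rel_ideal_add[of "r + s" "r' + s'"] by (simp add: algebra_simps)

lemma cong_mult_left: "r \<asymp> s \<Longrightarrow> t * r \<asymp> t * s"
  unfolding cong_rel_def using rel_ideal_mult(1)[of "r + s" t] by (simp add: algebra_simps)

lemma cong_mult_right: "r \<asymp> s \<Longrightarrow> r * t \<asymp> s * t"
  unfolding cong_rel_def using rel_ideal_mult(2)[of "r + s" t] by (simp add: algebra_simps)

lemma cong_act: "r \<asymp> s \<Longrightarrow> r \<bullet> g = s \<bullet> g"
  unfolding cong_rel_def using rel_ideal_act[of "r + s" g] by (simp add: falg_add_eq_0_iff)

text \<open>
  The commutation rule \<open>a * f = D f + aug f * a\<close> of the skew polynomial ring. The case of a word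
  starting with \<open>y\<close> is the defining relation.
\<close>
lemma ga_emb_cong: "ga * emb f \<asymp> emb (D f) + emb (aug f) * ga"
proof -
  have word: "ga * emb_word w \<asymp> emb (D_word w) + emb (aug_word w) * ga" for w
  proof (induction w rule: D_word.induct)
    case (2 w)
    show ?case by (simp add: emb_def mult.assoc)
  next
    case (3 w)
    have "ga * ga * gx * emb_word w \<asymp> ga * emb_word w"
      by (rule cong_mult_right) (use relator_in_rel_ideal in \<open>simp add: cong_rel_def add.commute\<close>)
    also note 3
    finally show ?case by (simp add: mult.assoc)
  qed simp
  show ?thesis
  proof (induction f rule: falg_induct)
    case (add w f)
    from cong_add[OF word[of w] add] show ?case
      by (simp add: emb_def D_def aug_def algebra_simps)
  qed simp
qed

lemma emb_ore_add: "\<exists>ts. emb_ore ps + emb_ore qs = emb_ore ts"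
proof (induction ps arbitrary: qs)
  case (Cons p ps)
  show ?case
  proof (cases qs)
    case Nil
    then show ?thesis by (intro exI[of _ "p # ps"]) simp
  next
    case (Cons q qs')
    obtain ts where "emb_ore ps + emb_ore qs' = emb_ore ts"
      using Cons.IH by blast
    from this[symmetric] have "emb_ore (p # ps) + emb_ore qs = emb_ore ((p + q) # ts)"
      by (simp add: Cons algebra_simps)
    then show ?thesis by blast
  qed
qed auto

lemma ga_emb_ore: "\<exists>ts. ga * emb_ore ps \<asymp> emb_ore ts"
proof (induction ps)
  case (Cons p ps)
  then obtain ts where ts: "ga * emb_ore ps \<asymp> emb_ore ts" by blast
  obtain us where us: "emb_ore [D p, aug p] + emb_ore (0 # ts) = emb_ore us"
    using emb_ore_add by blast
  have "ga * emb_ore (p # ps) \<asymp> emb_ore us"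
    using cong_add[OF ga_emb_cong[of p] cong_mult_right[OF ts, of ga]]
    by (simp add: algebra_simps flip: us)
  then show ?case by blast
qed (auto intro: exI[of _ "[]"])

lemma gx_emb_ore: "gx * emb_ore ps = emb_ore (map ((*) vx) ps)"
  by (induction ps) (simp_all add: emb_vx_mult distrib_left flip: mult.assoc)

lemma normal_form: "\<exists>ps. r \<asymp> emb_ore ps"
proof -
  have word: "\<exists>ps. wmon w \<asymp> emb_ore ps" for w
  proof (induction w)
    case Nil
    have "wmon [] \<asymp> emb_ore [1]" by (simp add: wmon_Nil)
    then show ?case by blast
  next
    case (Cons l w)
    then obtain ps where ps: "wmon w \<asymp> emb_ore ps" by blast
    have l: "wmon (l # w) \<asymp> wmon [l] * emb_ore ps"
      using cong_mult_left[OF ps, of "wmon [l]"] by (simp flip: wmon_Cons)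
    show ?case
    proof (cases l)
      case Gen_a
      then show ?thesis using l ga_emb_ore[of ps] cong_trans by blast
    next
      case Gen_x
      then show ?thesis using l gx_emb_ore[of ps] by metis
    qed
  qed
  show ?thesis
  proof (induction r rule: falg_induct)
    case zero
    show ?case by (rule exI[of _ "[]"]) simp
  next
    case (add w r)
    obtain ps qs where "wmon w \<asymp> emb_ore ps" "r \<asymp> emb_ore qs"
      using word add by blast
    then show ?case
      using cong_add emb_ore_add[of ps qs] by metis
  qed
qed

lemma act_eq_ore: "\<exists>ps. \<forall>g. r \<bullet> g = ore ps g"
  using normal_form[of r] cong_act emb_ore_act by metis

text \<open>
  The coefficients are read off from the values at \<open>vy\<close>, \<open>vy * vx\<close>, \<open>vy * vx\<^sup>2\<close>, \<open>\<dots>\<close>: the operator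
  \<open>D\<close> maps each of them to its predecessor, and \<open>vy\<close> to \<open>0\<close>.
\<close>
lemma ore_faithful:
  assumes "\<And>g. ore ps g = 0" "p \<in> set ps"
  shows "p = 0"
proof -
  have "\<forall>p\<in>set ps. p = 0" if "\<And>g. ore ps (vy * g) = 0"
    using that
  proof (induction ps)
    case (Cons p ps)
    have "p * vy = 0" using Cons.prems[of 1] by simp
    then have "p = 0" using right_decomp_eq_0_iff[of 0 p] by simp
    have "ore ps (vy * g) = 0" for g
      using Cons.prems[of "vx * g"] \<open>p = 0\<close> by simp
    with Cons.IH \<open>p = 0\<close> show ?case by simp
  qed simp
  with assms show ?thesis by blast
qed

lemma act_faithful:
  assumes "\<And>g. r \<bullet> g = 0"
  shows "r \<in> rel_ideal"
proof -
  obtain ps where ps: "r \<asymp> emb_ore ps" using normal_form by blast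
  then have "ore ps g = 0" for g
    using assms cong_act[of r "emb_ore ps" g] by simp
  then have "\<forall>p\<in>set ps. p = 0" using ore_faithful by blast
  then have "emb_ore ps = 0" by (induction ps) simp_all
  with ps show ?thesis by (simp add: cong_rel_def)
qed

section \<open>Units\<close>

definition inverses :: "gen falg \<Rightarrow> gen falg \<Rightarrow> bool" where
  "inverses u v \<longleftrightarrow> (\<forall>g. u \<bullet> v \<bullet> g = g \<and> v \<bullet> u \<bullet> g = g)"

lemma inverses_commute: "inverses u v \<Longrightarrow> inverses v u"
  by (simp add: inverses_def)

text \<open>
  Here \<open>ore_regular\<close> is applied to the skew polynomial of \<open>a * u\<close>, which kills \<open>v \<bullet> 1\<close>: its constant
  coefficient \<open>D (u \<bullet> 1)\<close> is zero. Hence only the constant coefficient of \<open>v\<close> contributes to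
  \<open>v \<bullet> u \<bullet> 1 = 1\<close>, and it is a left inverse of \<open>u \<bullet> 1\<close> in the free algebra.
\<close>
lemma unit_fixes_one:
  assumes "inverses u v"
  shows "u \<bullet> 1 = 1"
proof -
  obtain ps where ps: "\<And>g. (ga * u) \<bullet> g = ore ps g"
    using act_eq_ore by blast
  obtain qs where qs: "\<And>g. v \<bullet> g = ore qs g"
    using act_eq_ore by blast
  have D: "D (u \<bullet> 1) = 0"
  proof (cases ps)
    case Nil
    then show ?thesis using ps[of 1] by simp
  next
    case (Cons p ps')
    have "v \<bullet> 1 \<noteq> 0"
      using assms unfolding inverses_def by (metis act_right_simps(1) zero_neq_one)
    moreover have "ore (p # ps') (v \<bullet> 1) = 0"
      using ps[of "v \<bullet> 1"] assms by (simp add: inverses_def Cons)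
    ultimately have "p = 0" by (rule ore_regular[rotated])
    then show ?thesis using ps[of 1] by (simp add: Cons)
  qed
  have "ore qs (u \<bullet> 1) = 1"
    using qs[of "u \<bullet> 1"] assms by (simp add: inverses_def)
  then show ?thesis
    using D falg_left_inverse_trivial by (cases qs) auto
qed

lemma unit_decomp:
  assumes "inverses u v"
  obtains r where "\<And>g. u \<bullet> g = g + r \<bullet> D g"
proof -
  obtain ps where ps: "\<And>g. u \<bullet> g = ore ps g"
    using act_eq_ore by blast
  then have "ore ps 1 = 1" using unit_fixes_one[OF assms] by metis
  then obtain ps' where "ps = 1 # ps'" by (cases ps) auto
  with ps have "u \<bullet> g = g + emb_ore ps' \<bullet> D g" for g by simp
  then show ?thesis using that by blast
qed

text \<open>
  If \<open>u = 1 + r * a\<close>, then \<open>a * u = (1 + a * r) * a\<close>, and \<open>1 + a * r\<close> is again invertible, with inverse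
  \<open>1 - a * v * r\<close>.
\<close>
lemma unit_shift:
  assumes "inverses u v"
  obtains u' v' where "inverses u' v'"
    "\<And>g. D (u \<bullet> g) = u' \<bullet> D g" "\<And>g. D (v \<bullet> g) = v' \<bullet> D g"
proof -
  obtain r where r: "\<And>g. u \<bullet> g = g + r \<bullet> D g"
    using unit_decomp[OF assms] by blast
  let ?u = "1 + ga * r" and ?v = "1 + ga * v * r"
  have uv: "v \<bullet> g + r \<bullet> D (v \<bullet> g) = g" "v \<bullet> (g + r \<bullet> D g) = g" for g
    using assms r unfolding inverses_def by metis+
  have "?u \<bullet> ?v \<bullet> g = g" for g
  proof -
    have "?u \<bullet> ?v \<bullet> g = g + D (r \<bullet> g + (v \<bullet> (r \<bullet> g) + r \<bullet> D (v \<bullet> (r \<bullet> g))))"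
      by (simp add: algebra_simps)
    also have "\<dots> = g" by (simp only: uv falg_double D_simps add_0_right)
    finally show ?thesis .
  qed
  moreover have "?v \<bullet> ?u \<bullet> g = g" for g
  proof -
    have "?v \<bullet> ?u \<bullet> g = g + D (r \<bullet> g + v \<bullet> (r \<bullet> g + r \<bullet> D (r \<bullet> g)))"
      by (simp add: algebra_simps)
    also have "\<dots> = g" by (simp only: uv falg_double D_simps add_0_right)
    finally show ?thesis .
  qed
  ultimately have inv: "inverses ?u ?v" by (simp add: inverses_def)
  have Du: "D (u \<bullet> g) = ?u \<bullet> D g" for g by (simp add: r)
  have "D (v \<bullet> g) = ?v \<bullet> D g" for g
  proof -
    have "D (v \<bullet> g) = ?v \<bullet> ?u \<bullet> D (v \<bullet> g)"
      using inv unfolding inverses_def by metis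
    also have "\<dots> = ?v \<bullet> D (u \<bullet> v \<bullet> g)" by (simp only: Du)
    also have "\<dots> = ?v \<bullet> D g" using assms by (simp add: inverses_def)
    finally show ?thesis .
  qed
  with inv Du show ?thesis using that by blast
qed

lemma unit_shifts:
  assumes "inverses u v"
  shows "\<exists>u' v'. inverses u' v' \<and> (\<forall>g. (D ^^ n) (u \<bullet> g) = u' \<bullet> (D ^^ n) g) \<and>
    (\<forall>g. (D ^^ n) (v \<bullet> g) = v' \<bullet> (D ^^ n) g)"
proof (induction n)
  case 0
  then show ?case using assms by auto
next
  case (Suc n)
  then obtain u' v' where *: "inverses u' v'" "\<And>g. (D ^^ n) (u \<bullet> g) = u' \<bullet> (D ^^ n) g"
    "\<And>g. (D ^^ n) (v \<bullet> g) = v' \<bullet> (D ^^ n) g"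
    by blast
  obtain u'' v'' where "inverses u'' v''" "\<And>g. D (u' \<bullet> g) = u'' \<bullet> D g" "\<And>g. D (v' \<bullet> g) = v'' \<bullet> D g"
    using unit_shift[OF *(1)] by blast
  with * show ?case by (metis (no_types, lifting) comp_apply funpow.simps(2))
qed

text \<open>
  Polynomials in \<open>D\<close>, that is, skew polynomials in \<open>a\<close> with constant coefficients. They form a commutative
  polynomial ring, in which factors of a monomial are monomials.
\<close>
definition poly_D :: "bit poly \<Rightarrow> letter falg \<Rightarrow> letter falg" where
  "poly_D f = ore (map (\<lambda>c. if c = 0 then 0 else 1) (coeffs f))"

lemma poly_D_pCons: "poly_D (pCons c f) g = (if c = 0 then 0 else g) + poly_D f (D g)"
  by (cases "c = 0 \<and> f = 0") (auto simp: poly_D_def cCons_def)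

lemma poly_D_zero [simp]: "poly_D 0 g = 0"
  by (simp add: poly_D_def)

lemma poly_D_right_simps [simp]: "poly_D f 0 = 0" "poly_D f (g + h) = poly_D f g + poly_D f h"
  by (simp_all add: poly_D_def ore_add)

lemma poly_D_add [simp]: "poly_D (f + h) g = poly_D f g + poly_D h g"
proof (induction f h arbitrary: g rule: poly_induct2)
  case (pCons a f b h)
  have "(if a + b = 0 then 0 else g) = (if a = 0 then 0 else g) + (if b = 0 then 0 else g)"
    by (cases a; cases b) simp_all
  with pCons show ?case by (simp add: poly_D_pCons algebra_simps)
qed simp

lemma poly_D_commute: "poly_D f (D g) = D (poly_D f g)"
  by (induction f arbitrary: g) (simp_all add: poly_D_pCons)

lemma poly_D_mult [simp]: "poly_D (f * h) g = poly_D f (poly_D h g)"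
proof (induction f arbitrary: g)
  case (pCons c f)
  then show ?case
    by (cases c) (simp_all add: poly_D_pCons poly_D_commute)
qed simp

lemma poly_D_monom [simp]: "poly_D (monom 1 n) g = (D ^^ n) g"
  by (induction n arbitrary: g) (simp_all add: monom_0 monom_Suc poly_D_pCons funpow_swap1)

lemma poly_D_inject:
  assumes "\<And>g. poly_D f g = poly_D h g"
  shows "f = h"
proof -
  have "poly_D (f + h) g = 0" for g
    by (simp add: assms)
  then have "(if c = 0 then 0 else 1) = (0 :: letter falg)" if "c \<in> set (coeffs (f + h))" for c
    unfolding poly_D_def by (rule ore_faithful) (use that in auto)
  then have "\<forall>c\<in>set (coeffs (f + h)). c = 0"
    by (metis zero_neq_one)
  then have "f + h = 0"
    using range_coeff[of "f + h"] by (intro poly_eqI) (metis coeff_0 insert_iff rangeI)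
  moreover have "b + b = 0" for b :: bit
    by (cases b) simp_all
  then have "h + h = 0"
    by (intro poly_eqI) (simp only: coeff_add coeff_0)
  ultimately show ?thesis
    by (metis add_right_cancel)
qed

text \<open>
  Enough factors \<open>a\<close> on the left remove every \<open>x\<close>, because \<open>a ^ (k + 1) * x = a ^ k\<close> for \<open>k \<ge> 1\<close>. The
  successor in the exponent provides the last factor \<open>a\<close>, which this rule needs.
\<close>
lemma funpow_D_act_poly: "\<exists>n f. \<forall>g. (D ^^ Suc n) (r \<bullet> g) = poly_D f g"
proof -
  have word: "\<exists>n f. \<forall>g. (D ^^ Suc n) (act_word w g) = poly_D f g" for w
  proof (induction w)
    case Nil
    have "(D ^^ Suc 0) (act_word [] g) = poly_D (monom 1 1) g" for g
      by (simp del: One_nat_def) simp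
    then show ?case by blast
  next
    case (Cons l w)
    then obtain n f where nf: "\<And>g. (D ^^ Suc n) (act_word w g) = poly_D f g" by blast
    show ?case
    proof (cases l)
      case Gen_a
      have "(D ^^ Suc n) (act_word (l # w) g) = poly_D (pCons 0 f) g" for g
        using nf[of g] by (simp add: Gen_a poly_D_pCons poly_D_commute funpow_swap1)
      then show ?thesis by blast
    next
      case Gen_x
      have "(D ^^ Suc (Suc n)) (act_word (l # w) g) = poly_D f g" for g
        using nf[of g] by (simp add: Gen_x funpow_Suc_right del: funpow.simps)
      then show ?thesis by blast
    qed
  qed
  show ?thesis
  proof (induction r rule: falg_induct)
    case zero
    have "(D ^^ Suc 0) (0 \<bullet> g) = poly_D 0 g" for g by simp
    then show ?case by blast
  next
    case (add w r)
    obtain n f m h where nf: "\<And>g. (D ^^ Suc n) (act_word w g) = poly_D f g"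
      and mh: "\<And>g. (D ^^ Suc m) (r \<bullet> g) = poly_D h g"
      using word[of w] add by blast
    have "(D ^^ Suc (n + Suc m)) ((wmon w + r) \<bullet> g) =
        poly_D (monom 1 (Suc m) * f + monom 1 (Suc n) * h) g" for g
    proof -
      have "(D ^^ Suc (n + Suc m)) k = (D ^^ Suc m) ((D ^^ Suc n) k)"
        "(D ^^ Suc (n + Suc m)) k = (D ^^ Suc n) ((D ^^ Suc m) k)" for k
        by (simp_all only: add_Suc add_Suc_right add.commute[of n m] flip: funpow_add[THEN fun_cong, unfolded comp_apply])
      then show ?thesis
        by (simp only: act_simps D_funpow_simps poly_D_add poly_D_mult poly_D_monom
            nf[symmetric] mh[symmetric]) (simp add: act_def)
    qed
    then show ?case by blast
  qed
qed

lemma monom_factor: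
  assumes "f * h = monom 1 n"
  shows "\<exists>i. (f :: bit poly) = monom 1 i"
  using assms
proof (induction n arbitrary: f h)
  case 0
  then have "f dvd 1" by (metis dvd_triv_left monom_eq_1)
  then obtain c where "f = [:c:]" "c \<noteq> 0"
    by (auto simp: is_unit_poly_iff)
  then show ?case by (auto simp: monom_0 intro: exI[of _ 0])
next
  case (Suc n)
  have "poly f 0 * poly h 0 = 0"
    using arg_cong[OF Suc.prems, of "\<lambda>q. poly q 0"] by (simp add: poly_monom)
  then consider "poly f 0 = 0" | "poly h 0 = 0" by auto
  then show ?case
  proof cases
    case 1
    then obtain f' where f: "f = pCons 0 f'"
      by (metis pCons_cases poly_pCons mult_zero_left add.right_neutral)
    then have "f' * h = monom 1 n"
      using Suc.prems by (simp add: monom_Suc)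
    from Suc.IH[OF this] show ?thesis
      using f by (metis monom_Suc)
  next
    case 2
    then obtain h' where h: "h = pCons 0 h'"
      by (metis pCons_cases poly_pCons mult_zero_left add.right_neutral)
    then have "f * h' = monom 1 n"
      using Suc.prems by (simp add: monom_Suc)
    from Suc.IH[OF this] show ?thesis .
  qed
qed

lemma funpow_D_vx_power: "(D ^^ Suc n) (vx ^ n) = 0" "(D ^^ n) (vx ^ n) \<noteq> 0"
proof (induction n)
  case (Suc n)
  show "(D ^^ Suc (Suc n)) (vx ^ Suc n) = 0"
    using Suc(1) by (simp add: funpow_Suc_right del: funpow.simps)
  show "(D ^^ Suc n) (vx ^ Suc n) \<noteq> 0"
  proof (cases n)
    case 0
    then show ?thesis using vy_mult_eq_0_iff[of 1] by simp
  next
    case (Suc m)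
    then show ?thesis
      using \<open>(D ^^ n) (vx ^ n) \<noteq> 0\<close> by (simp add: funpow_Suc_right del: funpow.simps)
  qed
qed simp_all

text \<open>
  If \<open>i < n\<close>, the element \<open>vx ^ i\<close> is killed by \<open>D ^ n\<close>, hence by \<open>D ^ n\<close> after \<open>u\<close>, but not by \<open>D ^ i\<close>.
\<close>
lemma unit_D_power_le:
  assumes "inverses u v" "\<And>g. (D ^^ n) (u \<bullet> g) = (D ^^ i) g"
  shows "n \<le> i"
proof (rule ccontr)
  assume "\<not> n \<le> i"
  then obtain k where n: "n = k + Suc i" by (metis add.commute add_Suc_right less_imp_Suc_add not_le)
  obtain u' where u': "\<And>g. (D ^^ n) (u \<bullet> g) = u' \<bullet> (D ^^ n) g"
    using unit_shifts[OF assms(1)] by blast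
  have "(D ^^ i) (vx ^ i) = u' \<bullet> (D ^^ n) (vx ^ i)"
    using assms(2) u' by simp
  also have "(D ^^ n) (vx ^ i) = (D ^^ k) ((D ^^ Suc i) (vx ^ i))"
    by (simp only: n funpow_add comp_apply)
  also have "\<dots> = 0" by (simp only: funpow_D_vx_power D_funpow_simps)
  finally show False using funpow_D_vx_power(2) by simp
qed

text \<open>
  For large \<open>n\<close> and \<open>m\<close> the elements \<open>a ^ n * u\<close> and \<open>a ^ m * v\<close> are polynomials in \<open>a\<close>, and they commute
  with \<open>a\<close>, so their product is \<open>a ^ (m + n)\<close>. Both are therefore powers of \<open>a\<close>, with exponents at least \<open>n\<close> and \<open>m\<close>
  and with sum \<open>m + n\<close>.
\<close>
lemma unit_stable:
  assumes "inverses u v"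
  shows "\<exists>n. \<forall>g. (D ^^ n) (u \<bullet> g) = (D ^^ n) g"
proof -
  obtain n f where f: "\<And>g. (D ^^ n) (u \<bullet> g) = poly_D f g"
    using funpow_D_act_poly by blast
  obtain m h where h: "\<And>g. (D ^^ m) (v \<bullet> g) = poly_D h g"
    using funpow_D_act_poly by blast
  have pow: "poly_D q ((D ^^ k) g) = (D ^^ k) (poly_D q g)" for q k g
    by (induction k) (simp_all add: poly_D_commute)
  have "poly_D (f * h) g = poly_D (monom 1 (m + n)) g" for g
  proof -
    have "poly_D (f * h) g = (D ^^ m) ((D ^^ n) (u \<bullet> v \<bullet> g))"
      by (simp add: f pow flip: h)
    then show ?thesis using assms by (simp add: inverses_def funpow_add)
  qed
  then have fh: "f * h = monom 1 (m + n)"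
    by (rule poly_D_inject)
  then obtain i j where i: "f = monom 1 i" and j: "h = monom 1 j"
    using monom_factor[of f h] monom_factor[of h f] by (metis mult.commute)
  have "n \<le> i" "m \<le> j"
    using unit_D_power_le[OF assms, of n i] unit_D_power_le[OF inverses_commute[OF assms], of m j]
    by (simp_all add: f h i j)
  moreover have "i + j = m + n"
    using fh by (simp add: i j mult_monom monom_eq_iff')
  ultimately have "i = n" by linarith
  then show ?thesis using f i by auto
qed

text \<open>
  By induction \<open>(u + 1) ^ k\<close> factors through \<open>D ^ k\<close>: passing from \<open>k\<close> to \<open>k + 1\<close>, the operator \<open>D ^ k\<close> after
  \<open>u + 1\<close> equals \<open>u\<^sub>k + 1\<close> after \<open>D ^ k\<close> for a unit \<open>u\<^sub>k\<close>, and \<open>u\<^sub>k + 1\<close> ends in a further factor \<open>D\<close>.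
  For \<open>n\<close> as in \<open>unit_stable\<close>, the power \<open>(u + 1) ^ (n + 1)\<close> vanishes, since \<open>D ^ n\<close> is zero after \<open>u + 1\<close>.
\<close>
lemma unit_unipotent:
  assumes "inverses u v"
  shows "\<exists>n. (u + 1) ^ n \<in> rel_ideal"
proof -
  have factor: "\<exists>s. s 0 = 0 \<and> (\<forall>g. (u + 1) ^ k \<bullet> g = s ((D ^^ k) g))" for k
  proof (induction k)
    case (Suc k)
    then obtain s where s: "s 0 = 0" "\<And>g. (u + 1) ^ k \<bullet> g = s ((D ^^ k) g)" by blast
    obtain u' v' where u': "inverses u' v'" "\<And>g. (D ^^ k) (u \<bullet> g) = u' \<bullet> (D ^^ k) g"
      using unit_shifts[OF assms] by blast
    obtain r where r: "\<And>g. u' \<bullet> g = g + r \<bullet> D g"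
      using unit_decomp[OF u'(1)] by blast
    have "(u + 1) ^ Suc k \<bullet> g = s (r \<bullet> (D ^^ Suc k) g)" for g
    proof -
      have "(u + 1) ^ Suc k \<bullet> g = s ((D ^^ k) (u \<bullet> g + g))"
        by (simp only: power_Suc2 act_mult s act_simps)
      also have "(D ^^ k) (u \<bullet> g + g) = r \<bullet> (D ^^ Suc k) g"
        by (simp add: u' r add.commute)
      finally show ?thesis .
    qed
    then show ?case
      using s(1) by (intro exI[of _ "\<lambda>g. s (r \<bullet> g)"]) simp
  qed (auto intro: exI[of _ "\<lambda>g. g"])
  obtain n where n: "\<And>g. (D ^^ n) (u \<bullet> g) = (D ^^ n) g"
    using unit_stable[OF assms] by blast
  obtain s where s: "s 0 = 0" "\<And>g. (u + 1) ^ n \<bullet> g = s ((D ^^ n) g)"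
    using factor by blast
  have "(u + 1) ^ Suc n \<bullet> g = 0" for g
    by (simp only: power_Suc2 act_mult s act_simps D_funpow_simps n falg_double)
  then show ?thesis using act_faithful by blast
qed

text \<open>
  Representatives of a unit and of its inverse act as mutually inverse operators, because the relation
  ideal acts as zero.
\<close>
theorem theorem3p13:
  shows "UU_ring R_alg"
  unfolding UU_ring_def
proof (intro conjI ballI ring_R_alg)
  fix U
  assume U: "U \<in> Units R_alg"
  interpret I: ideal rel_ideal F2_free by (rule ideal_rel_ideal)
  interpret R: ring R_alg by (rule ring_R_alg)
  let ?\<pi> = "\<lambda>r. rel_ideal +>\<^bsub>F2_free\<^esub> r"
  have R_alg: "R_alg = F2_free Quot rel_ideal"
    by (simp add: R_alg_def rel_ideal_def)
  interpret h: ring_hom_ring F2_free R_alg ?\<pi>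
    unfolding R_alg by (rule I.rcos_ring_hom_ring)
  have surj: "\<exists>r. A = ?\<pi> r" if "A \<in> carrier R_alg" for A
    using that unfolding R_alg FactRing_def A_RCOSETS_def' by auto
  have minus: "\<ominus>\<^bsub>F2_free\<^esub> r = r" for r
    by (rule I.minus_equality) simp_all
  have pow: "r [^]\<^bsub>F2_free\<^esub> k = r ^ k" for r and k :: nat
    by (induction k) (simp_all add: power_Suc2 del: power_Suc)
  have eqD: "r \<asymp> s" if "?\<pi> r = ?\<pi> s" for r s
    using I.quotient_eq_iff_same_a_r_cos[OF ideal_rel_ideal, of r s] that by (simp add: a_minus_def minus cong_rel_def)
  have zero: "?\<pi> r = \<zero>\<^bsub>R_alg\<^esub>" if "r \<in> rel_ideal" for r
    unfolding R_alg FactRing_def using I.a_coset_join2[OF _ I.a_subgroup that] by simp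
  obtain V where V: "V \<in> carrier R_alg" "U \<otimes>\<^bsub>R_alg\<^esub> V = \<one>\<^bsub>R_alg\<^esub>" "V \<otimes>\<^bsub>R_alg\<^esub> U = \<one>\<^bsub>R_alg\<^esub>"
    using U by (auto simp: Units_def)
  obtain u v where u: "U = ?\<pi> u" and v: "V = ?\<pi> v"
    using surj U V(1) R.Units_closed by metis
  have "?\<pi> (u * v) = ?\<pi> 1" "?\<pi> (v * u) = ?\<pi> 1"
    using V h.hom_mult[of u v] h.hom_mult[of v u] h.hom_one by (simp_all add: u v)
  from this[THEN eqD, THEN cong_act] have "inverses u v"
    unfolding inverses_def by (metis act_mult act_simps(2))
  then obtain n where n: "(u + 1) ^ n \<in> rel_ideal"
    using unit_unipotent by blast
  have "U \<ominus>\<^bsub>R_alg\<^esub> \<one>\<^bsub>R_alg\<^esub> = ?\<pi> (u + 1)"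
    using h.hom_add[of u 1] h.hom_a_inv[of 1] h.hom_one by (simp add: a_minus_def u minus)
  moreover have "?\<pi> (u + 1) [^]\<^bsub>R_alg\<^esub> n = ?\<pi> ((u + 1) ^ n)"
    using pow[of "u + 1" n] h.hom_nat_pow[of "u + 1" n] by simp
  ultimately have "nilpotent R_alg (U \<ominus>\<^bsub>R_alg\<^esub> \<one>\<^bsub>R_alg\<^esub>)"
    using zero[OF n] h.hom_closed[of "u + 1"] unfolding nilpotent_def by auto
  then show "unipotent R_alg U"
    using R.Units_closed[OF U] by (simp add: unipotent_def)
qed

end
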